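(* Let $H$ be a graph with a cyclic ample framing and let $f\in\mathcal{F}^+(H)$. Then $f$ can be written uniquely as a sum $f=\sum_{\rho\in K}a_\rho\mathbf{1}_\rho$ with $a_\rho>0$, where $K\subseteq\mathrm{Routes}(H)$ is a set of pairwise compatible routes. Moreover, if $f$ is an integer flow, the coefficients $a_\rho$ are integers.
   Context: $H=(V,E)$ is a finite directed graph (possibly with directed cycles); sources and sinks have degree one, no idle edges, and every internal vertex has indegree 2 and outdegree 2. Minimal cycles: directed cycles (edge sets) with no proper subset a directed cycle. Routes: minimal cycles and directed source-to-sink walks; such a walk is good if it does not contain all edges of a minimal cycle consecutively; $\mathrm{Routes}(H)$ = minimal cycles and good routes. Cyclic ample framing: red/blue colouring of $E$ with distinct colours on the two incoming and two outgoing edges at each internal vertex, every minimal cycle monochromatic. Routes $\rho,\rho'$ are incompatible if both are source-to-sink walks and there is a common subwalk $S$ (possibly a vertex) with $\rho=PSQ$, $\rho'=P'SQ'$, last edge of $P$ and first edge of $Q'$ blue, first edge of $Q$ and last edge of $P'$ red; otherwise compatible. $\mathbf{1}_\rho\in\mathbb{R}^E$ is the indicator vector of the edges of $\rho$. $\mathcal{F}^+(H)$ is the set of $f\in\mathbb{R}_{\ge0}^E$ with $\sum_{\mathrm{out}(v)}f=\sum_{\mathrm{in}(v)}f$ at each internal vertex $v$; an integer flow is one with values in $\mathbb{Z}$. *)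

theory Defs
  imports
    Complex_Main
    "HOL-Library.Indicator_Function"
    "HOL-Library.Sublist"
    "Graph_Theory.Graph_Theory"
begin

section \<open>Graphs\<close>

text \<open>Parallel edges and loops are allowed; a loop is both an incoming and an outgoing edge of
  its vertex.\<close>

definition is_source :: "('v, 'e) pre_digraph \<Rightarrow> 'v \<Rightarrow> bool" where
  "is_source H v \<longleftrightarrow> v \<in> verts H \<and> in_degree H v = 0"

definition is_sink :: "('v, 'e) pre_digraph \<Rightarrow> 'v \<Rightarrow> bool" where
  "is_sink H v \<longleftrightarrow> v \<in> verts H \<and> out_degree H v = 0"

definition internal_verts :: "('v, 'e) pre_digraph \<Rightarrow> 'v set" where
  "internal_verts H = {v \<in> verts H. \<not> is_source H v \<and> \<not> is_sink H v}"

definition idle :: "('v, 'e) pre_digraph \<Rightarrow> 'e \<Rightarrow> bool" where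
  "idle H e \<longleftrightarrow> e \<in> arcs H \<and>
     (head H e \<in> internal_verts H \<and> in_arcs H (head H e) = {e} \<or>
      tail H e \<in> internal_verts H \<and> out_arcs H (tail H e) = {e})"

text \<open>The assumption \<open>no_idle\<close> is implied by the degree conditions at internal vertices; it is
  listed because it is part of the usual definition.\<close>

locale full_digraph = fin_digraph H for H :: "('v, 'e) pre_digraph" +
  assumes source_degree: "is_source H v \<Longrightarrow> in_degree H v + out_degree H v = 1"
    and sink_degree: "is_sink H v \<Longrightarrow> in_degree H v + out_degree H v = 1"
    and no_idle: "\<not> idle H e"
    and internal_in_degree: "v \<in> internal_verts H \<Longrightarrow> in_degree H v = 2"
    and internal_out_degree: "v \<in> internal_verts H \<Longrightarrow> out_degree H v = 2"

section \<open>Minimal cycles and routes\<close>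

text \<open>A directed cycle is the edge set of a nonempty closed directed walk. Repetitions need not
  be excluded here, since minimality with respect to inclusion does so.\<close>

definition directed_cycles :: "('v, 'e) pre_digraph \<Rightarrow> 'e set set" where
  "directed_cycles H = {set p |p u. p \<noteq> [] \<and> pre_digraph.awalk H u p u}"

definition minimal_cycles :: "('v, 'e) pre_digraph \<Rightarrow> 'e set set" where
  "minimal_cycles H = {C \<in> directed_cycles H. \<forall>D \<in> directed_cycles H. \<not> D \<subset> C}"

definition source_sink_walk :: "('v, 'e) pre_digraph \<Rightarrow> 'e list \<Rightarrow> bool" where
  "source_sink_walk H p \<longleftrightarrow>
     (\<exists>s t. is_source H s \<and> is_sink H t \<and> pre_digraph.awalk H s p t)"

text \<open>Here \<open>sublist\<close> denotes contiguous sublists.\<close>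

definition good_walk :: "('v, 'e) pre_digraph \<Rightarrow> 'e list \<Rightarrow> bool" where
  "good_walk H p \<longleftrightarrow> source_sink_walk H p \<and> \<not> (\<exists>q. sublist q p \<and> set q \<in> minimal_cycles H)"

datatype 'e route = Cycle_Route "'e set" | Walk_Route "'e list"

definition Routes :: "('v, 'e) pre_digraph \<Rightarrow> 'e route set" where
  "Routes H = Cycle_Route ` minimal_cycles H \<union> Walk_Route ` {p. good_walk H p}"

fun route_edges :: "'e route \<Rightarrow> 'e set" where
  "route_edges (Cycle_Route C) = C"
| "route_edges (Walk_Route p) = set p"

section \<open>Framings and compatibility\<close>

datatype colour = Red | Blue

locale cyclic_ample_framing = full_digraph H
  for H :: "('v, 'e) pre_digraph" and col :: "'e \<Rightarrow> colour" +
  assumes inj_in: "v \<in> internal_verts H \<Longrightarrow> inj_on col (in_arcs H v)"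
    and inj_out: "v \<in> internal_verts H \<Longrightarrow> inj_on col (out_arcs H v)"
    and minimal_cycle_mono: "C \<in> minimal_cycles H \<Longrightarrow> \<exists>c. \<forall>e \<in> C. col e = c"

text \<open>In \<open>crossing\<close>, the list \<open>S\<close> is the common subwalk. It may be empty, in which case the
  subwalk is a single vertex; the condition on the heads says that both walks
  start \<open>S\<close> at the same vertex, which is automatic for nonempty \<open>S\<close>.\<close>

definition crossing ::
    "('v, 'e) pre_digraph \<Rightarrow> ('e \<Rightarrow> colour) \<Rightarrow> 'e list \<Rightarrow> 'e list \<Rightarrow> bool" where
  "crossing H col r r' \<longleftrightarrow>
     (\<exists>P S Q P' Q'. r = P @ S @ Q \<and> r' = P' @ S @ Q' \<and>
        P \<noteq> [] \<and> Q \<noteq> [] \<and> P' \<noteq> [] \<and> Q' \<noteq> [] \<and>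
        head H (last P) = head H (last P') \<and>
        col (last P) = Blue \<and> col (hd Q') = Blue \<and>
        col (hd Q) = Red \<and> col (last P') = Red)"

text \<open>Incompatibility is a property of the unordered pair of routes, hence the symmetrization.\<close>

definition incompatible ::
    "('v, 'e) pre_digraph \<Rightarrow> ('e \<Rightarrow> colour) \<Rightarrow> 'e route \<Rightarrow> 'e route \<Rightarrow> bool" where
  "incompatible H col \<rho> \<rho>' \<longleftrightarrow>
     (\<exists>r r'. \<rho> = Walk_Route r \<and> \<rho>' = Walk_Route r' \<and>
        source_sink_walk H r \<and> source_sink_walk H r' \<and>
        (crossing H col r r' \<or> crossing H col r' r))"

abbreviation compatible ::
    "('v, 'e) pre_digraph \<Rightarrow> ('e \<Rightarrow> colour) \<Rightarrow> 'e route \<Rightarrow> 'e route \<Rightarrow> bool" where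
  "compatible H col \<rho> \<rho>' \<equiv> \<not> incompatible H col \<rho> \<rho>'"

section \<open>Flows\<close>

text \<open>Vectors indexed by the edges are functions of which only the values on \<open>arcs H\<close> matter.\<close>

definition nonneg_flows :: "('v, 'e) pre_digraph \<Rightarrow> ('e \<Rightarrow> real) set" where
  "nonneg_flows H = {f. (\<forall>e \<in> arcs H. 0 \<le> f e) \<and>
     (\<forall>v \<in> internal_verts H. (\<Sum>e \<in> out_arcs H v. f e) = (\<Sum>e \<in> in_arcs H v. f e))}"

definition integer_flow :: "('v, 'e) pre_digraph \<Rightarrow> ('e \<Rightarrow> real) \<Rightarrow> bool" where
  "integer_flow H f \<longleftrightarrow> f \<in> nonneg_flows H \<and> (\<forall>e \<in> arcs H. f e \<in> \<int>)"

definition route_decomposition ::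
    "('v, 'e) pre_digraph \<Rightarrow> ('e \<Rightarrow> colour) \<Rightarrow> ('e \<Rightarrow> real) \<Rightarrow> 'e route set \<Rightarrow>
      ('e route \<Rightarrow> real) \<Rightarrow> bool" where
  "route_decomposition H col f K a \<longleftrightarrow>
     finite K \<and> K \<subseteq> Routes H \<and> pairwise (compatible H col) K \<and>
     (\<forall>\<rho> \<in> K. 0 < a \<rho>) \<and>
     (\<forall>e \<in> arcs H. f e = (\<Sum>\<rho> \<in> K. a \<rho> * indicator (route_edges \<rho>) e))"

end

theory Submission
  imports Defs
begin

text \<open>Let \<open>N W\<close> be the total coefficient of the routes of a decomposition of \<open>f\<close> that contain the
  walk \<open>W\<close>. Suppose \<open>e\<close> and \<open>h\<close> have the same colour, and let \<open>e'\<close>, \<open>h'\<close> be the other edge with the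
  same head as \<open>e\<close>, respectively the same tail as \<open>h\<close>. A route through \<open>e S h'\<close> and a route through
  \<open>e' S h\<close> cross, so compatibility forces \<open>N (e S h) = min (N (e S)) (N (S h))\<close>; additivity then
  gives \<open>N (e S h')\<close>. Hence \<open>N\<close> is determined by its values \<open>f e\<close> on single edges, and it is
  integral if \<open>f\<close> is. Each coefficient is \<open>N W\<close> for a \<open>W\<close> contained in no other route.

  For existence, minimal cycles are pairwise disjoint because they are monochromatic, so one can
  subtract from \<open>f\<close> its minimum on each of them. The walks on which the recursion for \<open>N\<close> is then
  positive contain no minimal cycle, hence have bounded length, and extending them step by step in
  both directions shows that the values at source-sink walks form a decomposition.\<close>

section \<open>Lists, colours and indicator sums\<close>

lemma successively_propagate:
  assumes "successively R (x # p)" "x \<in> X"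
    and "\<And>x y. x \<in> X \<Longrightarrow> y \<in> set p \<Longrightarrow> R x y \<Longrightarrow> y \<in> X"
  shows "set (x # p) \<subseteq> X"
  using assms
proof (induction p arbitrary: x)
  case (Cons y p)
  have "y \<in> X" using Cons.prems(1,2) Cons.prems(3)[of x y] by (simp add: successively_Cons)
  moreover have "set (y # p) \<subseteq> X"
  proof (rule Cons.IH)
    show "successively R (y # p)" using Cons.prems(1) by (simp add: successively_Cons)
    show "z' \<in> X" if "z \<in> X" "z' \<in> set p" "R z z'" for z z'
      using Cons.prems(3)[of z z'] that by simp
  qed fact
  ultimately show ?case using Cons.prems(2) by simp
qed simp

lemma not_distinct_map_split:
  assumes "\<not> distinct (map g p)"
  obtains A x B y D where "p = A @ x # B @ y # D" "g x = g y"
proof -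
  obtain us c vs ws where "map g p = us @ c # vs @ c # ws"
    using not_distinct_decomp[OF assms] by auto
  then obtain A q where q: "p = A @ q" "map g q = c # vs @ c # ws"
    by (metis map_eq_append_conv)
  then obtain x q' where q': "q = x # q'" "g x = c" "map g q' = vs @ c # ws"
    by (metis map_eq_Cons_conv)
  then obtain B r where r: "q' = B @ r" "map g r = c # ws"
    by (metis map_eq_append_conv)
  then obtain y D where "r = y # D" "g y = c"
    by (metis map_eq_Cons_conv)
  then show thesis
    using that q q' r by metis
qed

lemma distinct_mapD: "distinct (map g p) \<Longrightarrow> x \<in> set p \<Longrightarrow> y \<in> set p \<Longrightarrow> g x = g y \<Longrightarrow> x = y"
  by (auto simp: distinct_map dest: inj_onD)

lemma card_two_other:
  assumes "card A = 2" "x \<in> A"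
  shows "\<exists>y. A = {x, y} \<and> x \<noteq> y"
  using assms by (auto simp: card_2_iff)

lemma colour_neq: "(c::colour) \<noteq> d \<Longrightarrow> c' \<noteq> d \<Longrightarrow> c = c'"
  by (cases c; cases d; cases c') auto

lemma sum_indicator_card:
  "finite A \<Longrightarrow> (\<Sum>x\<in>A. indicator C x :: real) = real (card (A \<inter> C))"
  by (simp add: indicator_def sum.If_cases)

section \<open>Walks and minimal cycles\<close>

context full_digraph
begin

definition walk :: "'e list \<Rightarrow> bool" where
  "walk p \<longleftrightarrow> set p \<subseteq> arcs H \<and> successively (\<lambda>x y. head H x = tail H y) p"

definition closed_walk :: "'e list \<Rightarrow> bool" where
  "closed_walk p \<longleftrightarrow> p \<noteq> [] \<and> walk p \<and> head H (last p) = tail H (hd p)"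

lemma walk_append:
  "walk (p @ q) \<longleftrightarrow> walk p \<and> walk q \<and> (p \<noteq> [] \<longrightarrow> q \<noteq> [] \<longrightarrow> head H (last p) = tail H (hd q))"
  by (auto simp: walk_def successively_append_iff)

lemma walk_Cons:
  "walk (x # q) \<longleftrightarrow> x \<in> arcs H \<and> walk q \<and> (q \<noteq> [] \<longrightarrow> head H x = tail H (hd q))"
  by (auto simp: walk_def successively_Cons)

lemma walk_Nil [simp]: "walk []"
  by (simp add: walk_def)

lemma walk_sublist: "walk p \<Longrightarrow> sublist q p \<Longrightarrow> walk q"
  by (auto simp: sublist_def walk_append)

lemma awalk_iff_walk:
  "p \<noteq> [] \<Longrightarrow> awalk u p v \<longleftrightarrow> walk p \<and> tail H (hd p) = u \<and> head H (last p) = v"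
proof (induction p arbitrary: u)
  case (Cons x p)
  show ?case
  proof (cases "p = []")
    case True
    then show ?thesis by (auto simp: awalk_Cons_iff walk_Cons awalk_Nil_iff)
  next
    case False
    then show ?thesis
      unfolding awalk_Cons_iff Cons.IH[OF False] walk_Cons by (auto simp del: last_in_set)
  qed
qed simp

lemma directed_cycles_iff: "D \<in> directed_cycles H \<longleftrightarrow> (\<exists>p. closed_walk p \<and> D = set p)"
  unfolding directed_cycles_def closed_walk_def using awalk_iff_walk by auto

lemma not_sink_source: "\<not> (is_source H v \<and> is_sink H v)"
  using source_degree[of v] unfolding is_source_def is_sink_def by linarith

text \<open>The empty walk drops out because its only vertex would be both a source and a sink, so
  its degrees would add up to 0 instead of 1.\<close>

lemma source_sink_walk_iff:
  "source_sink_walk H p \<longleftrightarrow>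
     p \<noteq> [] \<and> walk p \<and> is_source H (tail H (hd p)) \<and> is_sink H (head H (last p))"
proof (cases "p = []")
  case True
  then show ?thesis
    using not_sink_source by (auto simp: source_sink_walk_def awalk_Nil_iff)
next
  case False
  then show ?thesis
    by (auto simp: source_sink_walk_def awalk_iff_walk)
qed

lemma source_no_in: "is_source H v \<Longrightarrow> e \<in> arcs H \<Longrightarrow> head H e \<noteq> v"
  unfolding is_source_def in_degree_def using finite_in_arcs[of v] by auto

lemma sink_no_out: "is_sink H v \<Longrightarrow> e \<in> arcs H \<Longrightarrow> tail H e \<noteq> v"
  unfolding is_sink_def out_degree_def using finite_out_arcs[of v] by auto

lemma internal_headI: "e \<in> arcs H \<Longrightarrow> \<not> is_sink H (head H e) \<Longrightarrow> head H e \<in> internal_verts H"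
  using source_no_in by (auto simp: internal_verts_def)

lemma internal_tailI: "e \<in> arcs H \<Longrightarrow> \<not> is_source H (tail H e) \<Longrightarrow> tail H e \<in> internal_verts H"
  using sink_no_out by (auto simp: internal_verts_def)

lemma internal_joinI:
  "e \<in> arcs H \<Longrightarrow> h \<in> arcs H \<Longrightarrow> head H e = tail H h \<Longrightarrow> tail H h \<in> internal_verts H"
  using internal_tailI source_no_in by metis

text \<open>Membership in \<open>X\<close> spreads from \<open>x\<close> to the last edge, passes to
  the first edge because the walk is closed, and then spreads along the whole walk. With
  \<open>X\<close> a second cycle this yields inclusions between cycles.\<close>

lemma closed_walk_propagate:
  assumes p: "closed_walk p" and x: "x \<in> set p" "x \<in> X"
    and step: "\<And>x y. x \<in> X \<Longrightarrow> x \<in> set p \<Longrightarrow> y \<in> set p \<Longrightarrow> tail H y = head H x \<Longrightarrow> y \<in> X"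
  shows "set p \<subseteq> X"
proof -
  have walk: "walk p" and ne: "p \<noteq> []" and cl: "head H (last p) = tail H (hd p)"
    using p by (auto simp: closed_walk_def)
  obtain A B where AB: "p = A @ x # B" using x split_list by fastforce
  have "set (x # B) \<subseteq> X \<inter> set p"
    by (rule successively_propagate[where R = "\<lambda>x y. head H x = tail H y"])
      (use walk AB x step in \<open>auto simp: walk_def successively_append_iff\<close>)
  moreover have "last p \<in> set (x # B)" using AB by (metis last_appendR last_in_set list.discI)
  ultimately have "last p \<in> X" by auto
  then have "hd p \<in> X" using step[of "last p" "hd p"] ne cl by auto
  obtain y q where yq: "p = y # q" using ne by (cases p) auto
  have "set (y # q) \<subseteq> X \<inter> set p"
    by (rule successively_propagate[where R = "\<lambda>x y. head H x = tail H y"])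
      (use walk yq \<open>hd p \<in> X\<close> step in \<open>auto simp: walk_def\<close>)
  then show ?thesis using yq by auto
qed

lemma closed_walk_succ:
  assumes "closed_walk p" "x \<in> set p"
  shows "\<exists>y \<in> set p. tail H y = head H x"
proof -
  obtain A B where AB: "p = A @ x # B" using assms split_list by fastforce
  show ?thesis
  proof (cases B)
    case Nil
    then show ?thesis using assms(1) AB hd_in_set[of p] by (auto simp: closed_walk_def)
  next
    case (Cons y B')
    then show ?thesis using assms(1) AB by (auto simp: closed_walk_def walk_append walk_Cons)
  qed
qed

lemma closed_walk_pred:
  assumes "closed_walk p" "x \<in> set p"
  shows "\<exists>y \<in> set p. head H y = tail H x"
proof -
  obtain A B where AB: "p = A @ x # B" using assms split_list by fastforce
  show ?thesis
  proof (cases "A = []")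
    case True
    then show ?thesis using assms(1) AB last_in_set[of p]
      by (auto simp: closed_walk_def simp del: last_in_set)
  next
    case False
    then show ?thesis using assms(1) AB by (auto simp: closed_walk_def walk_append walk_Cons)
  qed
qed

text \<open>If the tails along \<open>q\<close> are distinct, the successor of an edge inside
  \<open>set q\<close> is unique, so a directed cycle inside \<open>set q\<close> is closed under
  successors and exhausts it. Otherwise the piece between two edges with equal tails is a shorter
  closed walk.\<close>

lemma closed_walk_contains_minimal:
  assumes "closed_walk q"
  shows "\<exists>q'. sublist q' q \<and> set q' \<in> minimal_cycles H"
  using assms
proof (induction "length q" arbitrary: q rule: less_induct)
  case less
  show ?case
  proof (cases "distinct (map (tail H) q)")
    case True
    have "\<not> D \<subset> set q" if "D \<in> directed_cycles H" for D
    proof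
      assume sub: "D \<subset> set q"
      obtain d where d: "closed_walk d" "D = set d"
        using \<open>D \<in> directed_cycles H\<close> directed_cycles_iff by auto
      have "hd d \<in> set d" using d by (auto simp: closed_walk_def)
      have "set q \<subseteq> D"
      proof (rule closed_walk_propagate[OF less.prems])
        show "hd d \<in> set q" "hd d \<in> D" using \<open>hd d \<in> set d\<close> d sub by auto
      next
        fix x y
        assume "x \<in> D" "y \<in> set q" "tail H y = head H x"
        moreover obtain z where "z \<in> D" "tail H z = head H x"
          using closed_walk_succ d \<open>x \<in> D\<close> by metis
        ultimately have "y = z"
          using True sub inj_onD[of "tail H" "set q" y z] by (auto simp: distinct_map)
        then show "y \<in> D" using \<open>z \<in> D\<close> by simp
      qed
      then show False using sub by auto
    qed
    then have "set q \<in> minimal_cycles H"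
      using less.prems directed_cycles_iff by (auto simp: minimal_cycles_def)
    then show ?thesis by blast
  next
    case False
    then obtain A x B y D where split: "q = A @ x # B @ y # D" "tail H x = tail H y"
      by (rule not_distinct_map_split)
    have "closed_walk (x # B)"
      using less.prems split by (auto simp: closed_walk_def walk_append walk_Cons)
    then obtain q' where "sublist q' (x # B)" "set q' \<in> minimal_cycles H"
      using less.hyps[of "x # B"] split by auto
    moreover have "sublist (x # B) q"
      using split by (metis append_Cons sublist_appendI)
    ultimately show ?thesis using sublist_order.order_trans by blast
  qed
qed

text \<open>A repeated tail or head cuts out a contiguous closed walk, which contains a minimal
  cycle. For equal heads the piece begins after the first of the two edges and ends with the
  second.\<close>

lemma acyclic_distinct:
  assumes walk: "walk p" and no: "\<And>q. sublist q p \<Longrightarrow> set q \<notin> minimal_cycles H"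
  shows "distinct (map (tail H) p)" "distinct (map (head H) p)"
proof -
  have no_closed: "\<not> closed_walk q" if "sublist q p" for q
    using that closed_walk_contains_minimal no sublist_order.order_trans by blast
  show "distinct (map (tail H) p)"
  proof (rule ccontr)
    assume "\<not> ?thesis"
    then obtain A x B y D where split: "p = A @ x # B @ y # D" "tail H x = tail H y"
      by (rule not_distinct_map_split)
    have "closed_walk (x # B)"
      using walk split by (auto simp: closed_walk_def walk_append walk_Cons)
    moreover have "sublist (x # B) p"
      using split by (metis append_Cons sublist_appendI)
    ultimately show False using no_closed by blast
  qed
  show "distinct (map (head H) p)"
  proof (rule ccontr)
    assume "\<not> ?thesis"
    then obtain A x B y D where split: "p = A @ x # B @ y # D" "head H x = head H y"
      by (rule not_distinct_map_split)
    have "closed_walk (B @ [y])"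
      using walk split by (cases B) (auto simp: closed_walk_def walk_append walk_Cons hd_append split: if_splits)
    moreover have "sublist (B @ [y]) p"
      using split sublist_appendI[of "B @ [y]" "A @ [x]" D] by simp
    ultimately show False using no_closed by blast
  qed
qed

lemma minimal_cycle_closed_walk:
  assumes "C \<in> minimal_cycles H"
  obtains p where "closed_walk p" "C = set p"
  using assms by (auto simp: minimal_cycles_def directed_cycles_iff)

lemma minimal_cycle_arcs: "C \<in> minimal_cycles H \<Longrightarrow> C \<subseteq> arcs H"
  by (auto simp: closed_walk_def walk_def elim!: minimal_cycle_closed_walk)

lemma minimal_cycle_succ: "C \<in> minimal_cycles H \<Longrightarrow> x \<in> C \<Longrightarrow> \<exists>y \<in> C. tail H y = head H x"
  using closed_walk_succ by (metis minimal_cycle_closed_walk)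

lemma minimal_cycle_pred: "C \<in> minimal_cycles H \<Longrightarrow> x \<in> C \<Longrightarrow> \<exists>y \<in> C. head H y = tail H x"
  using closed_walk_pred by (metis minimal_cycle_closed_walk)

lemma finite_minimal_cycles: "finite (minimal_cycles H)"
  by (rule finite_subset[of _ "Pow (arcs H)"]) (use minimal_cycle_arcs in auto)

end

text \<open>A cycle route is to be read as going around the cycle forever, so it contains every walk
  inside the cycle.\<close>

fun route_contains :: "'e route \<Rightarrow> 'e list \<Rightarrow> bool" where
  "route_contains (Walk_Route p) W \<longleftrightarrow> sublist W p"
| "route_contains (Cycle_Route C) W \<longleftrightarrow> set W \<subseteq> C"

lemma route_contains_sublist:
  "route_contains \<rho> W \<Longrightarrow> sublist V W \<Longrightarrow> route_contains \<rho> V"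
  by (cases \<rho>) (auto dest: sublist_order.order_trans set_mono_sublist)

lemma route_contains_set: "route_contains \<rho> W \<Longrightarrow> set W \<subseteq> route_edges \<rho>"
  by (cases \<rho>) (auto dest: set_mono_sublist)

lemma route_contains_singleton: "route_contains \<rho> [e] \<longleftrightarrow> e \<in> route_edges \<rho>"
  by (cases \<rho>) (auto simp: sublist_def dest: split_list)

text \<open>This is \<open>N\<close> of the overview. Containment is counted without multiplicity,
  in line with the indicator vectors.\<close>

definition through_weight :: "'e route set \<Rightarrow> ('e route \<Rightarrow> real) \<Rightarrow> 'e list \<Rightarrow> real" where
  "through_weight K a W = (\<Sum>\<rho> | \<rho> \<in> K \<and> route_contains \<rho> W. a \<rho>)"

lemma through_weight_split:
  assumes "finite K"
    and "\<And>\<rho>. \<rho> \<in> K \<Longrightarrow> route_contains \<rho> W \<longleftrightarrow> route_contains \<rho> U \<or> route_contains \<rho> V"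
    and "\<And>\<rho>. \<rho> \<in> K \<Longrightarrow> \<not> (route_contains \<rho> U \<and> route_contains \<rho> V)"
  shows "through_weight K a W = through_weight K a U + through_weight K a V"
proof -
  have "{\<rho> \<in> K. route_contains \<rho> W} =
    {\<rho> \<in> K. route_contains \<rho> U} \<union> {\<rho> \<in> K. route_contains \<rho> V}"
    using assms(2) by auto
  then show ?thesis unfolding through_weight_def
    using assms(1,3) by (simp add: sum.union_disjoint[symmetric] disjoint_iff)
qed

lemma through_weight_nonneg:
  assumes "\<And>\<rho>. \<rho> \<in> K \<Longrightarrow> 0 < a \<rho>"
  shows "0 \<le> through_weight K a W"
  unfolding through_weight_def using assms by (intro sum_nonneg) (auto intro: less_imp_le)

lemma through_weight_singleton:
  "finite K \<Longrightarrow>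
    through_weight K a [e] = (\<Sum>\<rho> \<in> K. a \<rho> * indicator (route_edges \<rho>) e)"
  unfolding through_weight_def route_contains_singleton
  by (auto intro!: sum.mono_neutral_cong_left simp: indicator_def)

lemma through_weight_ex: "through_weight K a W \<noteq> 0 \<Longrightarrow> \<exists>\<rho> \<in> K. route_contains \<rho> W"
  unfolding through_weight_def by (auto dest: sum.not_neutral_contains_not_neutral)

section \<open>The weight of a walk\<close>

context cyclic_ample_framing
begin

section \<open>Twin edges at internal vertices\<close>

definition out_twin :: "'e \<Rightarrow> 'e" where
  "out_twin h = (THE h'. h' \<in> arcs H \<and> tail H h' = tail H h \<and> h' \<noteq> h)"

definition in_twin :: "'e \<Rightarrow> 'e" where
  "in_twin e = (THE e'. e' \<in> arcs H \<and> head H e' = head H e \<and> e' \<noteq> e)"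

text \<open>Exactly two edges leave an internal vertex, so the description defining the twin has a
  unique solution there; at other vertices nothing is claimed about its value.\<close>

lemma out_twin:
  assumes "h \<in> arcs H" "tail H h \<in> internal_verts H"
  shows "out_arcs H (tail H h) = {h, out_twin h}" "out_twin h \<in> arcs H"
    "tail H (out_twin h) = tail H h" "col (out_twin h) \<noteq> col h" "out_twin h \<noteq> h"
    "out_twin (out_twin h) = h"
proof -
  obtain h' where h': "out_arcs H (tail H h) = {h, h'}" "h \<noteq> h'"
    using card_two_other[of "out_arcs H (tail H h)" h] internal_out_degree[OF assms(2)] assms(1)
    by (auto simp: out_degree_def)
  have mem: "x \<in> arcs H \<and> tail H x = tail H h \<longleftrightarrow> x = h \<or> x = h'" for x
    using h'(1) by (metis in_out_arcs_conv insert_iff singletonD)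
  have tw: "out_twin h = h'"
    unfolding out_twin_def using mem h'(2) by (intro the_equality) auto
  show "out_arcs H (tail H h) = {h, out_twin h}" using h'(1) tw by simp
  show "out_twin h \<in> arcs H" "tail H (out_twin h) = tail H h" using mem tw by auto
  show "out_twin h \<noteq> h" using h' tw by auto
  show "col (out_twin h) \<noteq> col h"
    using inj_out[OF assms(2)] h' tw by (auto simp: inj_on_def)
  show "out_twin (out_twin h) = h"
    unfolding tw unfolding out_twin_def using mem h'(2) by (intro the_equality) metis+
qed

lemma in_twin:
  assumes "e \<in> arcs H" "head H e \<in> internal_verts H"
  shows "in_arcs H (head H e) = {e, in_twin e}" "in_twin e \<in> arcs H"
    "head H (in_twin e) = head H e" "col (in_twin e) \<noteq> col e" "in_twin e \<noteq> e"
proof -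
  obtain e' where e': "in_arcs H (head H e) = {e, e'}" "e \<noteq> e'"
    using card_two_other[of "in_arcs H (head H e)" e] internal_in_degree[OF assms(2)] assms(1)
    by (auto simp: in_degree_def)
  have mem: "x \<in> arcs H \<and> head H x = head H e \<longleftrightarrow> x = e \<or> x = e'" for x
    using e'(1) by (metis in_in_arcs_conv insert_iff singletonD)
  have tw: "in_twin e = e'"
    unfolding in_twin_def using mem e'(2) by (intro the_equality) auto
  show "in_arcs H (head H e) = {e, in_twin e}" using e'(1) tw by simp
  show "in_twin e \<in> arcs H" "head H (in_twin e) = head H e" using mem tw by auto
  show "in_twin e \<noteq> e" using e' tw by auto
  show "col (in_twin e) \<noteq> col e"
    using inj_in[OF assms(2)] e' tw by (auto simp: inj_on_def)
qed

lemma flow_balance: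
  assumes "f \<in> nonneg_flows H" "e \<in> arcs H" "h \<in> arcs H" "head H e = tail H h"
  shows "f e + f (in_twin e) = f h + f (out_twin h)"
proof -
  have int: "tail H h \<in> internal_verts H" using internal_joinI assms by blast
  have "in_arcs H (tail H h) = {e, in_twin e}" "in_twin e \<noteq> e"
    using in_twin[of e] assms int by simp_all
  moreover have "out_arcs H (tail H h) = {h, out_twin h}" "out_twin h \<noteq> h"
    using out_twin[of h] assms int by simp_all
  moreover have "sum f (out_arcs H (tail H h)) = sum f (in_arcs H (tail H h))"
    using assms(1) int by (auto simp: nonneg_flows_def)
  ultimately show ?thesis by (simp add: insert_Diff_if eq_commute)
qed

text \<open>The recursion satisfied by \<^term>\<open>through_weight K a\<close> on nonempty walks, whose readable form
  is \<open>weight_ends\<close> below.\<close>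

function weight :: "('e \<Rightarrow> real) \<Rightarrow> 'e list \<Rightarrow> real" where
  "weight f [] = 0"
| "weight f [e] = f e"
| "weight f (e # x # T) =
     (if col e = col (last (x # T))
      then min (weight f (e # butlast (x # T))) (weight f (x # T))
      else max 0 (weight f (e # butlast (x # T)) -
             weight f (butlast (x # T) @ [out_twin (last (x # T))])))"
  by pat_completeness auto
termination by (relation "measure (\<lambda>(f, W). length W)") auto

text \<open>For distinct colours, \<open>e\<close> and \<open>out_twin h\<close> agree in colour.
  Subtracting the minimum for the twin from \<open>weight f (e # S)\<close> gives x - min x y = max
  0 (x - y); in this form the recursion only calls shorter walks.\<close>

lemma weight_ends:
  "weight f (e # S @ [h]) =
     (if col e = col h then min (weight f (e # S)) (weight f (S @ [h]))
      else max 0 (weight f (e # S) - weight f (S @ [out_twin h])))"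
proof -
  obtain x T where xT: "S @ [h] = x # T" by (cases "S @ [h]") auto
  then have "last (x # T) = h" "butlast (x # T) = S" by (metis last_snoc, metis butlast_snoc)
  then show ?thesis unfolding xT by simp
qed

declare weight.simps(3) [simp del]

section \<open>Additivity, sign and integrality of the weight\<close>

lemma snoc_internal:
  assumes "walk (S @ [h])" "S \<noteq> []"
  shows "h \<in> arcs H" "tail H h \<in> internal_verts H" "head H (last S) = tail H h"
proof -
  have S: "last S \<in> arcs H"
    using assms by (auto simp: walk_append walk_def)
  show "h \<in> arcs H" "head H (last S) = tail H h"
    using assms by (auto simp: walk_append walk_Cons)
  then show "tail H h \<in> internal_verts H" using internal_joinI[OF S] by simp
qed

lemma Cons_internal:
  assumes "walk (e # T)" "T \<noteq> []"
  shows "e \<in> arcs H" "head H e \<in> internal_verts H" "head H e = tail H (hd T)"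
proof -
  have T: "hd T \<in> arcs H"
    using assms by (cases T) (auto simp: walk_Cons)
  show "e \<in> arcs H" "head H e = tail H (hd T)"
    using assms by (auto simp: walk_Cons)
  then show "head H e \<in> internal_verts H" using internal_joinI[OF _ T] by simp
qed

lemma walk_snoc_twin:
  assumes "walk (S @ [h])" "S \<noteq> []"
  shows "walk (S @ [out_twin h])"
  using out_twin(2,3)[OF snoc_internal(1,2)[OF assms]] assms
  by (auto simp: walk_append walk_Cons)

lemma walk_Cons_twin:
  assumes "walk (e # T)" "T \<noteq> []"
  shows "walk (in_twin e # T)"
  using in_twin(2,3)[OF Cons_internal(1,2)[OF assms]] assms
  by (auto simp: walk_Cons)

text \<open>Exactly one of \<open>h\<close> and its twin has the colour of the first edge of
  \<open>S\<close>. The two extensions therefore receive min x y and max 0 (x - y), whose sum is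
  x.\<close>

lemma weight_split_out:
  assumes "walk (S @ [h])" "S \<noteq> []"
  shows "weight f S = weight f (S @ [h]) + weight f (S @ [out_twin h])"
proof -
  obtain e S' where S: "S = e # S'" using assms by (cases S) auto
  note t = out_twin[OF snoc_internal(1,2)[OF assms]]
  have "col e = col h \<longleftrightarrow> col e \<noteq> col (out_twin h)"
    using t(4) colour_neq by metis
  then show ?thesis
    using S weight_ends[of f e S' h] weight_ends[of f e S' "out_twin h"] t(6) by auto
qed

text \<open>Exactly one of \<open>e\<close> and its twin has the colour of \<open>h\<close>; its
  extension receives min x y with y = \<open>weight f (S @ [h])\<close>. The balance turns the
  difference in the other extension into y - x, so the sum is y.\<close>

lemma weight_split_in_step:
  assumes f: "f \<in> nonneg_flows H" and walk: "walk (e # S @ [h])"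
    and bal: "weight f (e # S) + weight f (in_twin e # S) =
      weight f (S @ [h]) + weight f (S @ [out_twin h])"
  shows "weight f (S @ [h]) = weight f (e # S @ [h]) + weight f (in_twin e # S @ [h])"
proof -
  have "col (in_twin e) \<noteq> col e" using in_twin(4) Cons_internal[OF walk] by simp
  then have "col e = col h \<longleftrightarrow> col (in_twin e) \<noteq> col h" using colour_neq by metis
  then show ?thesis using bal by (auto simp: weight_ends)
qed

text \<open>Flow conservation for a walk \<open>S\<close> in place of a vertex, the vertex being the
  case of empty \<open>S\<close>. Given the balance at \<open>S\<close>, splitting on the left and
  splitting on the right show that both sides of the balance at \<open>S @ [x]\<close> equal
  \<open>weight f (S @ [x])\<close>.\<close>

lemma weight_balance:
  assumes f: "f \<in> nonneg_flows H"
  shows "walk (e # S @ [h]) \<Longrightarrow>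
    weight f (e # S) + weight f (in_twin e # S) = weight f (S @ [h]) + weight f (S @ [out_twin h])"
proof (induction S arbitrary: h rule: rev_induct)
  case Nil
  then show ?case using flow_balance[OF f] by (auto simp: walk_Cons)
next
  case (snoc x S)
  have w: "walk (e # S @ [x])" "walk ((S @ [x]) @ [h])"
    using snoc.prems walk_append[of "e # S @ [x]" "[h]"] walk_Cons[of e] by auto
  have "weight f (S @ [x]) = weight f (e # S @ [x]) + weight f (in_twin e # S @ [x])"
    using weight_split_in_step[OF f w(1) snoc.IH[OF w(1)]] .
  then show ?case using weight_split_out[OF w(2), of f] by simp
qed

lemma weight_split_in:
  assumes "f \<in> nonneg_flows H" "walk (e # T)" "T \<noteq> []"
  shows "weight f T = weight f (e # T) + weight f (in_twin e # T)"
  using weight_split_in_step[OF assms(1), of e "butlast T" "last T"]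
    weight_balance[OF assms(1), of e "butlast T" "last T"] assms by simp

lemma weight_nonneg:
  assumes "f \<in> nonneg_flows H"
  shows "walk W \<Longrightarrow> 0 \<le> weight f W"
proof (induction "length W" arbitrary: W rule: less_induct)
  case less
  consider "W = []" | e where "W = [e]" | e S h where "W = e # S @ [h]"
    by (metis rev_exhaust neq_Nil_conv)
  then show ?case
  proof cases
    case 2
    then show ?thesis using less.prems assms by (auto simp: walk_Cons nonneg_flows_def)
  next
    case 3
    then have "walk (e # S)" "walk (S @ [h])"
      using less.prems walk_append[of "e # S" "[h]"] walk_Cons[of e "S @ [h]"] by auto
    then show ?thesis using less.hyps[of "e # S"] less.hyps[of "S @ [h]"] 3
      by (auto simp: weight_ends)
  qed simp
qed

lemma weight_integer:
  assumes "\<And>e. e \<in> arcs H \<Longrightarrow> f e \<in> \<int>"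
  shows "walk W \<Longrightarrow> weight f W \<in> \<int>"
proof (induction "length W" arbitrary: W rule: less_induct)
  case less
  consider "W = []" | e where "W = [e]" | e S h where "W = e # S @ [h]"
    by (metis rev_exhaust neq_Nil_conv)
  then show ?case
  proof cases
    case 2
    then show ?thesis using less.prems assms by (auto simp: walk_Cons)
  next
    case 3
    then have w: "walk (e # S)" "walk (S @ [h])"
      using less.prems walk_append[of "e # S" "[h]"] walk_Cons[of e "S @ [h]"] by auto
    have "walk (S @ [out_twin h])"
    proof (cases "S = []")
      \<comment> \<open>Here \<open>e\<close> plays the role of the missing last edge of
        \<open>S\<close>: it makes the tail of \<open>h\<close> internal, so the twin is an
        arc.\<close>
      case True
      then show ?thesis using less.prems 3 out_twin(2)[of h] internal_joinI[of e h]
        by (auto simp: walk_Cons)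
    qed (use w walk_snoc_twin in blast)
    with w have "weight f (e # S) \<in> \<int>" "weight f (S @ [h]) \<in> \<int>"
      "weight f (S @ [out_twin h]) \<in> \<int>"
      using less.hyps 3 by simp_all
    then show ?thesis using 3 by (auto simp: weight_ends min_def max_def)
  qed simp
qed

section \<open>Passage of routes through internal vertices\<close>

lemma good_walkD:
  assumes "good_walk H p"
  shows "p \<noteq> []" "walk p" "is_source H (tail H (hd p))" "is_sink H (head H (last p))"
    "distinct (map (tail H) p)" "distinct (map (head H) p)"
  using assms acyclic_distinct[of p] by (auto simp: good_walk_def source_sink_walk_iff)

lemma route_cases:
  assumes "\<rho> \<in> Routes H"
  obtains (Walk) p where "\<rho> = Walk_Route p" "good_walk H p"
  | (Cycle) C c where "\<rho> = Cycle_Route C" "C \<in> minimal_cycles H" "\<forall>e \<in> C. col e = c"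
proof -
  from assms consider p where "\<rho> = Walk_Route p" "good_walk H p"
    | C where "\<rho> = Cycle_Route C" "C \<in> minimal_cycles H"
    unfolding Routes_def by blast
  then show thesis
  proof cases
    case (2 C)
    then show thesis using minimal_cycle_mono Cycle by metis
  qed (rule Walk)
qed

lemma route_edges_arcs:
  assumes "\<rho> \<in> Routes H"
  shows "route_edges \<rho> \<subseteq> arcs H"
  using assms
proof (cases rule: route_cases)
  case (Walk p)
  then show ?thesis using good_walkD(2)[of p] by (simp add: walk_def)
next
  case (Cycle C c)
  then show ?thesis using minimal_cycle_arcs[of C] by simp
qed

text \<open>A good walk never repeats a head, and a minimal cycle is monochromatic while the two
  edges entering an internal vertex differ in colour.\<close>

lemma route_edges_same_head:
  assumes "\<rho> \<in> Routes H" "x \<in> route_edges \<rho>" "y \<in> route_edges \<rho>" "head H x = head H y"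
    "head H x \<in> internal_verts H"
  shows "x = y"
  using assms(1)
proof (cases rule: route_cases)
  case (Walk p)
  then show ?thesis using assms good_walkD(6) distinct_mapD[of "head H" p x y] by auto
next
  case (Cycle C c)
  have "x \<in> in_arcs H (head H x)" "y \<in> in_arcs H (head H x)"
    using assms route_edges_arcs[of \<rho>] by auto
  then show ?thesis using Cycle assms inj_onD[OF inj_in[of "head H x"], of x y] by auto
qed

lemma route_edges_same_tail:
  assumes "\<rho> \<in> Routes H" "x \<in> route_edges \<rho>" "y \<in> route_edges \<rho>" "tail H x = tail H y"
    "tail H x \<in> internal_verts H"
  shows "x = y"
  using assms(1)
proof (cases rule: route_cases)
  case (Walk p)
  then show ?thesis using assms good_walkD(5) distinct_mapD[of "tail H" p x y] by auto
next
  case (Cycle C c)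
  have "x \<in> out_arcs H (tail H x)" "y \<in> out_arcs H (tail H x)"
    using assms route_edges_arcs[of \<rho>] by auto
  then show ?thesis using Cycle assms inj_onD[OF inj_out[of "tail H x"], of x y] by auto
qed

text \<open>The vertex at the end of \<open>W\<close> is internal, so a route cannot stop there and
  must leave by exactly one of the two outgoing edges.\<close>

lemma route_contains_snoc:
  assumes \<rho>: "\<rho> \<in> Routes H" and W: "walk (W @ [h])" "W \<noteq> []"
  shows "route_contains \<rho> W \<longleftrightarrow>
      route_contains \<rho> (W @ [h]) \<or> route_contains \<rho> (W @ [out_twin h])"
    and "\<not> (route_contains \<rho> (W @ [h]) \<and> route_contains \<rho> (W @ [out_twin h]))"
proof -
  note int = snoc_internal[OF W]
  note t = out_twin[OF int(1,2)]
  have mem: "x = h \<or> x = out_twin h" if "x \<in> arcs H" "tail H x = head H (last W)" for x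
    using t(1) int(3) that by (metis in_out_arcs_conv insert_iff singletonD)
  show "\<not> (route_contains \<rho> (W @ [h]) \<and> route_contains \<rho> (W @ [out_twin h]))"
    using route_edges_same_tail[OF \<rho>, of h "out_twin h"] t int
    by (auto dest!: route_contains_set)
  show "route_contains \<rho> W \<longleftrightarrow>
      route_contains \<rho> (W @ [h]) \<or> route_contains \<rho> (W @ [out_twin h])" (is "?L \<longleftrightarrow> ?R")
  proof
    assume ?R
    then show ?L using route_contains_sublist sublist_append_rightI by blast
  next
    assume L: ?L
    from \<rho> show ?R
    proof (cases rule: route_cases)
      case (Walk p)
      then obtain A B where p: "p = A @ W @ B" using L by (auto simp: sublist_def)
      \<comment> \<open>A good walk ends at a sink, whereas \<open>W\<close> ends at an internal
        vertex.\<close>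
      have "B \<noteq> []"
        using good_walkD(4)[OF Walk(2)] p W int by (auto simp: internal_verts_def)
      then obtain b B' where B: "B = b # B'" by (cases B) auto
      have "b = h \<or> b = out_twin h"
        using good_walkD(2)[OF Walk(2)] p B W(2) mem by (auto simp: walk_append walk_Cons)
      moreover have "sublist (W @ [b]) p" using p B by (auto simp: sublist_def)
      ultimately show ?thesis using Walk by auto
    next
      case (Cycle C c)
      then obtain b where "b \<in> C" "tail H b = head H (last W)"
        using L minimal_cycle_succ[of C "last W"] last_in_set[OF W(2)] by auto
      then have "b = h \<or> b = out_twin h" "b \<in> C"
        using mem minimal_cycle_arcs Cycle by auto
      then show ?thesis using Cycle L by auto
    qed
  qed
qed

lemma route_contains_Cons:
  assumes \<rho>: "\<rho> \<in> Routes H" and W: "walk (e # W)" "W \<noteq> []"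
  shows "route_contains \<rho> W \<longleftrightarrow> route_contains \<rho> (e # W) \<or> route_contains \<rho> (in_twin e # W)"
    and "\<not> (route_contains \<rho> (e # W) \<and> route_contains \<rho> (in_twin e # W))"
proof -
  note int = Cons_internal[OF W]
  note t = in_twin[OF int(1,2)]
  have mem: "x = e \<or> x = in_twin e" if "x \<in> arcs H" "head H x = tail H (hd W)" for x
    using t(1) int(3) that by (metis in_in_arcs_conv insert_iff singletonD)
  show "\<not> (route_contains \<rho> (e # W) \<and> route_contains \<rho> (in_twin e # W))"
    using route_edges_same_head[OF \<rho>, of e "in_twin e"] t int
    by (auto dest!: route_contains_set)
  show "route_contains \<rho> W \<longleftrightarrow> route_contains \<rho> (e # W) \<or> route_contains \<rho> (in_twin e # W)"
    (is "?L \<longleftrightarrow> ?R")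
  proof
    assume ?R
    then show ?L using route_contains_sublist[of \<rho> _ W] by (auto simp: sublist_Cons_right)
  next
    assume L: ?L
    from \<rho> show ?R
    proof (cases rule: route_cases)
      case (Walk p)
      then obtain A B where p: "p = A @ W @ B" using L by (auto simp: sublist_def)
      have "A \<noteq> []"
        using good_walkD(3)[OF Walk(2)] p W int by (auto simp: internal_verts_def)
      then obtain b A' where A: "A = A' @ [b]" by (cases A rule: rev_cases) auto
      have "b = e \<or> b = in_twin e"
        using good_walkD(2)[OF Walk(2)] p A W(2) mem by (auto simp: walk_append walk_Cons)
      moreover have "sublist (b # W) p" using p A by (auto simp: sublist_def)
      ultimately show ?thesis using Walk by auto
    next
      case (Cycle C c)
      then obtain b where "b \<in> C" "head H b = tail H (hd W)"
        using L minimal_cycle_pred[of C "hd W"] hd_in_set[OF W(2)] by (auto simp del: hd_in_set)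
      then have "b = e \<or> b = in_twin e" "b \<in> C"
        using mem minimal_cycle_arcs Cycle by auto
      then show ?thesis using Cycle L by auto
    qed
  qed
qed

section \<open>Through-weights of compatible decompositions\<close>

lemma through_weight_split_out:
  assumes "finite K" "K \<subseteq> Routes H" "walk (W @ [h])" "W \<noteq> []"
  shows "through_weight K a W = through_weight K a (W @ [h]) + through_weight K a (W @ [out_twin h])"
  by (rule through_weight_split) (use assms route_contains_snoc in blast)+

lemma through_weight_split_in:
  assumes "finite K" "K \<subseteq> Routes H" "walk (e # W)" "W \<noteq> []"
  shows "through_weight K a W = through_weight K a (e # W) + through_weight K a (in_twin e # W)"
  by (rule through_weight_split) (use assms route_contains_Cons in blast)+

text \<open>Cycle routes are monochromatic. This puts the routes of the crossing argument among the
  walks, the only routes that can be incompatible.\<close>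

lemma bicoloured_route_is_walk:
  assumes "\<rho> \<in> Routes H" "route_contains \<rho> (e # S @ [h])" "col e \<noteq> col h"
  obtains p where "\<rho> = Walk_Route p" "good_walk H p" "sublist (e # S @ [h]) p"
  using assms(1)
proof (cases rule: route_cases)
  case (Walk p)
  then show ?thesis using that assms by auto
next
  case (Cycle C c)
  then show ?thesis using assms by auto
qed

lemma crossingI:
  assumes "head H x = head H x'" "col x = Blue" "col k' = Blue" "col k = Red" "col x' = Red"
  shows "crossing H col ((A @ [x]) @ S @ k # B) ((A' @ [x']) @ S @ k' # B')"
proof -
  have "(A @ [x]) @ S @ k # B = (A @ [x]) @ S @ (k # B) \<and>
    (A' @ [x']) @ S @ k' # B' = (A' @ [x']) @ S @ (k' # B') \<and>
    A @ [x] \<noteq> [] \<and> k # B \<noteq> [] \<and> A' @ [x'] \<noteq> [] \<and> k' # B' \<noteq> [] \<and>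
    head H (last (A @ [x])) = head H (last (A' @ [x'])) \<and>
    col (last (A @ [x])) = Blue \<and> col (hd (k' # B')) = Blue \<and>
    col (hd (k # B)) = Red \<and> col (last (A' @ [x'])) = Red"
    using assms by simp
  then show ?thesis
    unfolding crossing_def by (intro exI)
qed

text \<open>Both contained walks have ends of different colours, so both routes are walks. They
  enter and leave \<open>S\<close> by opposite twins and cross there; the colour of \<open>e\<close>
  only decides which of them comes first in \<open>crossing\<close>.\<close>

lemma no_opposite_crossing:
  assumes K: "K \<subseteq> Routes H" "pairwise (compatible H col) K"
    and \<rho>: "\<rho> \<in> K" "route_contains \<rho> (e # S @ [h'])"
    and \<sigma>: "\<sigma> \<in> K" "route_contains \<sigma> (e' # S @ [h])"
    and walk: "walk (e # S @ [h])"
    and e': "e' = in_twin e" and h': "h' = out_twin h" and col: "col e = col h"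
  shows False
proof -
  have int: "e \<in> arcs H" "head H e \<in> internal_verts H" using Cons_internal[OF walk] by auto
  note te = in_twin[OF int, folded e']
  have int': "h \<in> arcs H" "tail H h \<in> internal_verts H"
    using snoc_internal[of "e # S" h] walk by auto
  note th = out_twin[OF int', folded h']
  have c1: "col e \<noteq> col h'" and c2: "col e' \<noteq> col h" using te th col by auto
  obtain p where p: "\<rho> = Walk_Route p" "good_walk H p" "sublist (e # S @ [h']) p"
    using bicoloured_route_is_walk[OF _ \<rho>(2) c1] \<rho>(1) K by blast
  obtain q where q: "\<sigma> = Walk_Route q" "good_walk H q" "sublist (e' # S @ [h]) q"
    using bicoloured_route_is_walk[OF _ \<sigma>(2) c2] \<sigma>(1) K by blast
  \<comment> \<open>Pairwise compatibility speaks only about distinct routes; these two enter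
    \<open>S\<close> by different edges with the same head.\<close>
  have "\<rho> \<noteq> \<sigma>"
  proof
    assume "\<rho> = \<sigma>"
    then have "e \<in> route_edges \<rho>" "e' \<in> route_edges \<rho>"
      using \<rho>(2) \<sigma>(2) by (auto dest!: route_contains_set)
    then show False
      using route_edges_same_head[of \<rho> e e'] K \<rho>(1) te int by auto
  qed
  then have "\<not> incompatible H col \<rho> \<sigma>" using K \<rho> \<sigma> by (auto simp: pairwise_def)
  moreover obtain A B where "p = (A @ [e]) @ S @ (h' # B)" using p(3) by (auto simp: sublist_def)
  moreover obtain A' B' where "q = (A' @ [e']) @ S @ (h # B')" using q(3) by (auto simp: sublist_def)
  moreover have "head H e = head H e'" using te by simp
  moreover have "source_sink_walk H p" "source_sink_walk H q" using p q by (auto simp: good_walk_def)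
  ultimately have nc: "\<not> crossing H col p q" "\<not> crossing H col q p"
    using p q unfolding incompatible_def by auto
  have eqs: "p = (A @ [e]) @ S @ (h' # B)" "q = (A' @ [e']) @ S @ (h # B')"
    "head H e = head H e'" by fact+
  show False
  proof (cases "col e")
    case Blue
    then have "col h = Blue" "col h' = Red" "col e' = Red"
      using col c1 c2 by (metis colour.exhaust)+
    then have "crossing H col p q"
      unfolding eqs using eqs(3) Blue by (intro crossingI) auto
    then show False using nc by simp
  next
    case Red
    then have "col h = Red" "col h' = Blue" "col e' = Blue"
      using col c1 c2 by (metis colour.exhaust)+
    then have "crossing H col q p"
      unfolding eqs using eqs(3) Red by (intro crossingI) auto
    then show False using nc by simp
  qed
qed

lemma through_weight_same_colour:
  assumes K: "finite K" "K \<subseteq> Routes H" "pairwise (compatible H col) K"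
    and pos: "\<And>\<rho>. \<rho> \<in> K \<Longrightarrow> 0 < a \<rho>"
    and walk: "walk (e # S @ [h])" and col: "col e = col h"
  shows "through_weight K a (e # S @ [h]) =
    min (through_weight K a (e # S)) (through_weight K a (S @ [h]))"
proof -
  let ?N = "through_weight K a"
  have out: "?N (e # S) = ?N (e # S @ [h]) + ?N (e # S @ [out_twin h])"
    using through_weight_split_out[OF K(1,2), of "e # S" h a] walk by simp
  have "in": "?N (S @ [h]) = ?N (e # S @ [h]) + ?N (in_twin e # S @ [h])"
    using through_weight_split_in[OF K(1,2) walk] by simp
  \<comment> \<open>If both were nonzero, each walk would lie in some route of \<open>K\<close>, and
    these routes would cross. With one remainder zero and the other nonnegative, the two splittings
    give the minimum.\<close>
  have "?N (e # S @ [out_twin h]) = 0 \<or> ?N (in_twin e # S @ [h]) = 0"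
    using no_opposite_crossing[OF K(2,3) _ _ _ _ walk refl refl col] through_weight_ex by metis
  moreover have "0 \<le> ?N (e # S @ [out_twin h])" "0 \<le> ?N (in_twin e # S @ [h])"
    using through_weight_nonneg[of K a] pos by auto
  ultimately show ?thesis using out "in" by linarith
qed

lemma through_weight_eq_weight:
  assumes dec: "route_decomposition H col f K a"
  shows "walk W \<Longrightarrow> W \<noteq> [] \<Longrightarrow> through_weight K a W = weight f W"
proof (induction "length W" arbitrary: W rule: less_induct)
  case less
  have K: "finite K" "K \<subseteq> Routes H" "pairwise (compatible H col) K"
    and pos: "\<And>\<rho>. \<rho> \<in> K \<Longrightarrow> 0 < a \<rho>"
    and sum: "\<And>e. e \<in> arcs H \<Longrightarrow> f e = (\<Sum>\<rho> \<in> K. a \<rho> * indicator (route_edges \<rho>) e)"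
    using dec by (auto simp: route_decomposition_def)
  consider e where "W = [e]" | e S h where "W = e # S @ [h]"
    using less.prems by (metis rev_exhaust neq_Nil_conv)
  then show ?case
  proof cases
    case 1
    then show ?thesis
      using through_weight_singleton[OF K(1)] sum[of e] less.prems by (simp add: walk_Cons)
  next
    case 2
    note walk = less.prems(1)[unfolded 2]
    have w: "walk (e # S)" "walk (S @ [h])"
      using walk walk_append[of "e # S" "[h]"] walk_Cons[of e "S @ [h]"] by auto
    note int = snoc_internal[of "e # S" h, simplified, OF walk]
    note t = out_twin[OF int(1,2)]
    have wt': "walk (e # S @ [out_twin h])" using walk_snoc_twin[of "e # S" h] walk by simp
    then have wt: "walk (S @ [out_twin h])" by (simp add: walk_Cons)
    have IH: "through_weight K a (e # S) = weight f (e # S)"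
      "through_weight K a (S @ [h]) = weight f (S @ [h])"
      "through_weight K a (S @ [out_twin h]) = weight f (S @ [out_twin h])"
      using less.hyps w wt 2 by simp_all
    show ?thesis
    proof (cases "col e = col h")
      case True
      then show ?thesis
        using through_weight_same_colour[OF K pos walk True] 2 IH by (simp add: weight_ends)
    next
      case False
      \<comment> \<open>The minimum formula applies to the twin extension; the value at
        \<open>h\<close> is what remains of the weight of \<open>e # S\<close>.\<close>
      then have "col e = col (out_twin h)" using t(4) colour_neq by metis
      from through_weight_same_colour[OF K pos wt' this] show ?thesis
        using through_weight_split_out[OF K(1,2), of "e # S" h a] walk False 2 IH
        by (simp add: weight_ends)
    qed
  qed
qed

text \<open>No edge enters a source and none leaves a sink.\<close>

lemma source_sink_maximal:
  assumes p: "good_walk H p" and q: "walk q" "sublist p q"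
  shows "q = p"
proof -
  obtain A B where AB: "q = A @ p @ B" using q by (auto simp: sublist_def)
  note P = good_walkD[OF p]
  have "A = []"
  proof (rule ccontr)
    assume "A \<noteq> []"
    then have "head H (last A) = tail H (hd p)"
      using AB q(1) P(1) by (simp add: walk_append)
    moreover have "last A \<in> arcs H"
      using \<open>A \<noteq> []\<close> AB q(1) by (auto simp: walk_def)
    ultimately show False using source_no_in[OF P(3)] by auto
  qed
  moreover have "B = []"
  proof (rule ccontr)
    assume "B \<noteq> []"
    then have "head H (last p) = tail H (hd B)"
      using AB q(1) P(1) by (simp add: walk_append)
    moreover have "hd B \<in> arcs H"
      using \<open>B \<noteq> []\<close> AB q(1) by (auto simp: walk_def)
    ultimately show False using sink_no_out[OF P(4)] by auto
  qed
  ultimately show ?thesis using AB by simp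
qed

section \<open>Uniqueness and integrality\<close>

text \<open>For a walk route the walk itself serves: it cannot be extended, and its first edge lies
  on no cycle because nothing enters a source. For a cycle route a closed walk around it serves:
  good walks avoid it, and a minimal cycle containing it is the same cycle.\<close>

lemma route_witness:
  assumes "\<rho> \<in> Routes H"
  shows "\<exists>W. W \<noteq> [] \<and> walk W \<and> (\<forall>\<sigma> \<in> Routes H. route_contains \<sigma> W \<longleftrightarrow> \<sigma> = \<rho>)"
  using assms
proof (cases rule: route_cases)
  case (Walk p)
  note P = good_walkD[OF Walk(2)]
  have "route_contains \<sigma> p \<longleftrightarrow> \<sigma> = \<rho>" if "\<sigma> \<in> Routes H" for \<sigma>
    using that
  proof (cases rule: route_cases)
    case (Walk q)
    then show ?thesis
      using source_sink_maximal[OF \<open>good_walk H p\<close>, of q] good_walkD(2) \<open>\<rho> = Walk_Route p\<close> by auto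
  next
    case (Cycle C c)
    have "hd p \<notin> C"
      using minimal_cycle_pred[of C "hd p"] minimal_cycle_arcs[of C] Cycle source_no_in[OF P(3)] by blast
    then show ?thesis using Cycle Walk P(1) hd_in_set[of p] by (auto simp del: hd_in_set)
  qed
  then show ?thesis using P by blast
next
  case (Cycle C c)
  obtain p where p: "closed_walk p" "C = set p" using minimal_cycle_closed_walk Cycle by metis
  have "route_contains \<sigma> p \<longleftrightarrow> \<sigma> = \<rho>" if "\<sigma> \<in> Routes H" for \<sigma>
    using that
  proof (cases rule: route_cases)
    case (Walk q)
    then show ?thesis using Cycle p by (auto simp: good_walk_def)
  next
    case (Cycle D d)
    then show ?thesis
      using \<open>\<rho> = Cycle_Route C\<close> \<open>C \<in> minimal_cycles H\<close> p by (auto simp: minimal_cycles_def)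
  qed
  then show ?thesis using p by (auto simp: closed_walk_def)
qed

text \<open>\<open>W\<close> is chosen before \<open>K\<close> and \<open>a\<close>, so two
  decompositions can be compared through the same weight. The value 0 records absence from
  \<open>K\<close>.\<close>

lemma coefficient_eq_weight:
  assumes "\<rho> \<in> Routes H"
  shows "\<exists>W. walk W \<and> (\<forall>K a. route_decomposition H col f K a \<longrightarrow>
    weight f W = (if \<rho> \<in> K then a \<rho> else 0))"
proof -
  obtain W where W: "W \<noteq> []" "walk W" "\<And>\<sigma>. \<sigma> \<in> Routes H \<Longrightarrow> route_contains \<sigma> W \<longleftrightarrow> \<sigma> = \<rho>"
    using route_witness[OF assms] by blast
  have "weight f W = (if \<rho> \<in> K then a \<rho> else 0)" if dec: "route_decomposition H col f K a" for K a
  proof -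
    have "{\<sigma> \<in> K. route_contains \<sigma> W} = (if \<rho> \<in> K then {\<rho>} else {})"
      using dec W(3) by (auto simp: route_decomposition_def)
    then have "through_weight K a W = (if \<rho> \<in> K then a \<rho> else 0)"
      unfolding through_weight_def by simp
    then show ?thesis using through_weight_eq_weight[OF dec W(2,1)] by simp
  qed
  then show ?thesis using W by blast
qed

lemma decomposition_unique:
  assumes dec: "route_decomposition H col f K a" and dec': "route_decomposition H col f K' a'"
  shows "K = K'" "\<And>\<rho>. \<rho> \<in> K \<Longrightarrow> a \<rho> = a' \<rho>"
proof -
  have eq: "(if \<rho> \<in> K then a \<rho> else 0) = (if \<rho> \<in> K' then a' \<rho> else 0)" if "\<rho> \<in> Routes H" for \<rho>
    using coefficient_eq_weight[OF that, of f] dec dec' by metis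
  have sub: "K \<subseteq> Routes H" "K' \<subseteq> Routes H" and pos: "\<forall>\<rho> \<in> K. 0 < a \<rho>" "\<forall>\<rho> \<in> K'. 0 < a' \<rho>"
    using dec dec' by (auto simp: route_decomposition_def)
  show K: "K = K'"
  proof (rule set_eqI)
    fix \<rho>
    show "\<rho> \<in> K \<longleftrightarrow> \<rho> \<in> K'"
      \<comment> \<open>Coefficients are positive, so they never coincide with the default
        0.\<close>
      using eq[of \<rho>] sub pos by (cases "\<rho> \<in> K"; cases "\<rho> \<in> K'") force+
  qed
  show "a \<rho> = a' \<rho>" if "\<rho> \<in> K" for \<rho> using eq[of \<rho>] sub K that by auto
qed

lemma decomposition_integer:
  assumes "integer_flow H f" "route_decomposition H col f K a" "\<rho> \<in> K"
  shows "a \<rho> \<in> \<int>"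
proof -
  have "\<rho> \<in> Routes H" using assms by (auto simp: route_decomposition_def)
  then obtain W where "walk W" "weight f W = a \<rho>"
    using coefficient_eq_weight assms by metis
  then show ?thesis using weight_integer[of f W] assms(1) by (auto simp: integer_flow_def)
qed

section \<open>Existence\<close>

lemma minimal_cycle_next_unique:
  assumes "C \<in> minimal_cycles H" "D \<in> minimal_cycles H" "x \<in> C" "x \<in> D"
    "y \<in> C" "z \<in> D" "tail H y = tail H z" "tail H y \<in> internal_verts H"
  shows "y = z"
proof -
  obtain c where c: "\<forall>e \<in> C. col e = c" using minimal_cycle_mono assms(1) by blast
  obtain d where d: "\<forall>e \<in> D. col e = d" using minimal_cycle_mono assms(2) by blast
  \<comment> \<open>The common edge \<open>x\<close> forces the two monochromatic cycles to have the
    same colour.\<close>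
  have "col y = col z" using c d assms by metis
  moreover have "y \<in> out_arcs H (tail H y)" "z \<in> out_arcs H (tail H y)"
    using assms minimal_cycle_arcs by auto
  ultimately show ?thesis using inj_onD[OF inj_out[OF assms(8)]] by blast
qed

text \<open>From a common edge onwards the two cycles must continue alike, so following
  \<open>C\<close> never leaves \<open>D\<close>; minimality then gives equality.\<close>

lemma minimal_cycles_disjoint:
  assumes C: "C \<in> minimal_cycles H" and D: "D \<in> minimal_cycles H" and e: "e \<in> C" "e \<in> D"
  shows "C = D"
proof -
  obtain p where p: "closed_walk p" "C = set p" using minimal_cycle_closed_walk C by metis
  have "C \<subseteq> D" unfolding p(2)
  proof (rule closed_walk_propagate[OF p(1)])
    show "e \<in> set p" "e \<in> D" using e p by auto
    fix x y assume xy: "x \<in> D" "x \<in> set p" "y \<in> set p" "tail H y = head H x"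
    obtain z where z: "z \<in> D" "tail H z = head H x" using minimal_cycle_succ[OF D xy(1)] by blast
    have "x \<in> arcs H" "y \<in> arcs H" using xy p C minimal_cycle_arcs by auto
    then have "tail H y \<in> internal_verts H" using internal_joinI xy by metis
    then have "y = z" using minimal_cycle_next_unique[OF C D, of x y z] xy z p by simp
    then show "y \<in> D" using z by simp
  qed
  then show ?thesis using C D by (auto simp: minimal_cycles_def)
qed

text \<open>Being monochromatic, \<open>C\<close> has at most one edge into \<open>v\<close> and at
  most one out of it, and it has one exactly if it has the other.\<close>

lemma minimal_cycle_balance:
  assumes C: "C \<in> minimal_cycles H" and v: "v \<in> internal_verts H"
  shows "(\<Sum>e \<in> out_arcs H v. indicator C e :: real) = (\<Sum>e \<in> in_arcs H v. indicator C e)"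
proof -
  obtain c where c: "\<forall>e \<in> C. col e = c" using minimal_cycle_mono C by blast
  have card_le: "card (A \<inter> C) \<le> Suc 0" if "inj_on col A" "finite A" for A
  proof -
    have "x = y" if "x \<in> A \<inter> C" "y \<in> A \<inter> C" for x y
      using inj_onD[OF \<open>inj_on col A\<close>, of x y] c that by simp
    then show ?thesis using \<open>finite A\<close> by (simp add: card_le_Suc0_iff_eq)
  qed
  have "card (out_arcs H v \<inter> C) \<le> Suc 0" "card (in_arcs H v \<inter> C) \<le> Suc 0"
    using card_le[OF inj_out[OF v] finite_out_arcs] card_le[OF inj_in[OF v] finite_in_arcs] by simp_all
  moreover have "out_arcs H v \<inter> C = {} \<longleftrightarrow> in_arcs H v \<inter> C = {}"
  proof
    assume out: "out_arcs H v \<inter> C = {}"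
    show "in_arcs H v \<inter> C = {}"
    proof (rule equals0I)
      fix x assume x: "x \<in> in_arcs H v \<inter> C"
      then obtain y where "y \<in> C" "tail H y = v" using minimal_cycle_succ[OF C, of x] by auto
      then have "y \<in> out_arcs H v \<inter> C" using minimal_cycle_arcs[OF C] by auto
      then show False using out by simp
    qed
  next
    assume "in": "in_arcs H v \<inter> C = {}"
    show "out_arcs H v \<inter> C = {}"
    proof (rule equals0I)
      fix x assume x: "x \<in> out_arcs H v \<inter> C"
      then obtain y where "y \<in> C" "head H y = v" using minimal_cycle_pred[OF C, of x] by auto
      then have "y \<in> in_arcs H v \<inter> C" using minimal_cycle_arcs[OF C] by auto
      then show False using "in" by simp
    qed
  qed
  then have "card (out_arcs H v \<inter> C) = 0 \<longleftrightarrow> card (in_arcs H v \<inter> C) = 0"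
    by (simp add: card_eq_0_iff finite_out_arcs finite_in_arcs)
  ultimately have "card (out_arcs H v \<inter> C) = card (in_arcs H v \<inter> C)" by linarith
  then show ?thesis by (simp add: sum_indicator_card finite_out_arcs finite_in_arcs)
qed

section \<open>Walks of positive weight\<close>

lemma weight_sublist_le:
  assumes f: "f \<in> nonneg_flows H" and W: "walk W" "sublist V W" "V \<noteq> []"
  shows "weight f W \<le> weight f V"
proof -
  \<comment> \<open>Each added edge splits off the weight of the twin extension, which is
    nonnegative; \<open>left\<close> does the same at the other end.\<close>
  have right: "walk (V @ B) \<Longrightarrow> weight f (V @ B) \<le> weight f V" for B
  proof (induction B rule: rev_induct)
    case (snoc h B)
    have w: "walk ((V @ B) @ [h])" using snoc.prems by simp
    have "weight f (V @ B) = weight f ((V @ B) @ [h]) + weight f ((V @ B) @ [out_twin h])"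
      using weight_split_out[OF w] W(3) by simp
    moreover have "0 \<le> weight f ((V @ B) @ [out_twin h])"
      using weight_nonneg[OF f walk_snoc_twin[OF w]] W(3) by simp
    moreover have "weight f (V @ B) \<le> weight f V" using snoc.IH w walk_append[of "V @ B"] by blast
    ultimately show ?case by simp
  qed simp
  have left: "walk (A @ U) \<Longrightarrow> U \<noteq> [] \<Longrightarrow> weight f (A @ U) \<le> weight f U" for A U
  proof (induction A)
    case (Cons e A)
    have w: "walk (e # A @ U)" "A @ U \<noteq> []" using Cons.prems by auto
    have "weight f (A @ U) = weight f (e # A @ U) + weight f (in_twin e # A @ U)"
      using weight_split_in[OF f w] .
    moreover have "0 \<le> weight f (in_twin e # A @ U)"
      using weight_nonneg[OF f walk_Cons_twin[OF w]] .
    moreover have "weight f (A @ U) \<le> weight f U" using Cons.IH w Cons.prems(2) walk_Cons by blast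
    ultimately show ?case by simp
  qed simp
  obtain A B where AB: "W = A @ V @ B" using W(2) by (auto simp: sublist_def)
  have "weight f W \<le> weight f (V @ B)" using left[of A "V @ B"] W AB by simp
  also have "\<dots> \<le> weight f V" using right W(1) AB walk_append by blast
  finally show ?thesis .
qed

text \<open>Positivity passes to the subwalks around the crossing. Their ends differ in colour, so
  each positive value is a positive difference; the two resulting strict inequalities add up to a
  contradiction with \<open>weight_balance\<close>.\<close>

lemma positive_weight_no_crossing:
  assumes f: "f \<in> nonneg_flows H" and r: "walk r" "0 < weight f r" and r': "walk r'" "0 < weight f r'"
  shows "\<not> crossing H col r r'"
proof
  assume "crossing H col r r'"
  then obtain P S Q P' Q' where *: "r = P @ S @ Q" "r' = P' @ S @ Q'"
    "P \<noteq> []" "Q \<noteq> []" "P' \<noteq> []" "Q' \<noteq> []" "head H (last P) = head H (last P')"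
    and colours: "col (last P) = Blue" "col (hd Q') = Blue" "col (hd Q) = Red" "col (last P') = Red"
    unfolding crossing_def by (elim exE conjE)
  \<comment> \<open>The edges \<open>e\<close>, \<open>h\<close> are blue and \<open>e'\<close>,
    \<open>h'\<close> red; \<open>r\<close> contains \<open>e # S @ [h']\<close> and
    \<open>r'\<close> contains \<open>e' # S @ [h]\<close>.\<close>
  define e e' h h' where "e = last P" "e' = last P'" "h = hd Q'" "h' = hd Q"
  note defs = this
  have sub: "sublist (e # S @ [h']) r"
    unfolding sublist_def defs *(1)
    by (rule exI[of _ "butlast P"], rule exI[of _ "tl Q"]) (simp add: *(3-6))
  have sub': "sublist (e' # S @ [h]) r'"
    unfolding sublist_def defs *(2)
    by (rule exI[of _ "butlast P'"], rule exI[of _ "tl Q'"]) (simp add: *(3-6))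
  have w: "walk (e # S @ [h'])" and w': "walk (e' # S @ [h])"
    using walk_sublist r r' sub sub' by blast+
  have pos: "0 < weight f (e # S @ [h'])" "0 < weight f (e' # S @ [h])"
    using weight_sublist_le[OF f r(1) sub] weight_sublist_le[OF f r'(1) sub'] r r' by auto
  have c: "col e = Blue" "col h = Blue" "col h' = Red" "col e' = Red" unfolding defs by (fact colours)+
  have he: "head H e' = head H e" unfolding defs using *(7) by simp
  have e'_twin: "in_twin e = e'"
  proof -
    have "e' \<in> in_arcs H (head H e)" using Cons_internal(1)[OF w'] he by simp
    then show ?thesis using in_twin(1)[OF Cons_internal(1,2)[OF w]] c by auto
  qed
  have h_twin: "out_twin h' = h" "out_twin h = h'"
  proof -
    note i = snoc_internal[of "e # S" h', simplified, OF w]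
    note i' = snoc_internal[of "e' # S" h, simplified, OF w']
    \<comment> \<open>For empty \<open>S\<close> the tails agree because \<open>P\<close> and
      \<open>P'\<close> end at the same vertex; otherwise both are the head of the last edge of
      \<open>S\<close>.\<close>
    have "tail H h = tail H h'" using i(3) i'(3) he by (auto split: if_splits)
    then have "h \<in> out_arcs H (tail H h')" using i'(1) by simp
    then show "out_twin h' = h" using out_twin(1)[OF i(1,2)] c by auto
    then show "out_twin h = h'" using out_twin(6)[OF i(1,2)] by simp
  qed
  have "weight f (S @ [h]) < weight f (e # S)" "weight f (S @ [h']) < weight f (e' # S)"
    using pos c h_twin by (auto simp: weight_ends split: if_splits)
  then show False using weight_balance[OF f w] e'_twin h_twin by simp
qed

lemma positive_weight_acyclic:
  assumes f: "f \<in> nonneg_flows H" and zero: "\<And>C. C \<in> minimal_cycles H \<Longrightarrow> \<exists>e \<in> C. f e = 0"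
    and W: "walk W" "0 < weight f W" "sublist q W"
  shows "set q \<notin> minimal_cycles H"
proof
  assume "set q \<in> minimal_cycles H"
  then obtain e where e: "e \<in> set q" "f e = 0" using zero by blast
  then have "sublist [e] q" by (auto simp: sublist_def dest: split_list)
  then have "sublist [e] W" using W(3) sublist_order.order_trans by blast
  then show False using weight_sublist_le[OF f W(1), of "[e]"] e W(2) by simp
qed

definition positive_walks :: "('e \<Rightarrow> real) \<Rightarrow> 'e route set" where
  "positive_walks f = Walk_Route ` {p. good_walk H p \<and> 0 < weight f p}"

lemma finite_positive_walks: "finite (positive_walks f)"
proof -
  have "{p. good_walk H p \<and> 0 < weight f p} \<subseteq> {p. set p \<subseteq> arcs H \<and> distinct p}"
    using good_walkD(2,5) by (auto simp: walk_def distinct_map)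
  then show ?thesis
    unfolding positive_walks_def
    using finite_subset finite_subset_distinct[OF finite_arcs] by blast
qed

lemma positive_walks_Routes: "positive_walks f \<subseteq> Routes H"
  by (auto simp: positive_walks_def Routes_def)

text \<open>Both sides split in the same way under extension, so the claim for \<open>W\<close>
  follows from longer walks. The extension stops when \<open>W\<close> has nonpositive weight, where
  both sides vanish, or runs from source to sink, where \<open>W\<close> is the only route
  containing it.\<close>

lemma through_weight_positive_walks:
  assumes f: "f \<in> nonneg_flows H" and zero: "\<And>C. C \<in> minimal_cycles H \<Longrightarrow> \<exists>e \<in> C. f e = 0"
    and a: "\<And>p. a (Walk_Route p) = weight f p"
  shows "walk W \<Longrightarrow> W \<noteq> [] \<Longrightarrow> through_weight (positive_walks f) a W = weight f W"
\<comment> \<open>Walks of positive weight repeat no edge, which bounds their length by the number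
  of arcs. The \<open>Suc\<close> lets the measure still drop when that bound is attained.\<close>
proof (induction "Suc (card (arcs H)) - length W" arbitrary: W rule: less_induct)
  case less
  note W = less.prems
  let ?K = "positive_walks f"
  show ?case
  proof (cases "0 < weight f W")
    case False
    \<comment> \<open>A good walk containing \<open>W\<close> has at most the weight of
      \<open>W\<close>, so it is not positive.\<close>
    then have "{\<rho> \<in> ?K. route_contains \<rho> W} = {}"
      using weight_sublist_le[OF f _ _ W(2)] good_walkD(2) by (force simp: positive_walks_def)
    then have "through_weight ?K a W = 0" unfolding through_weight_def by (simp only: sum.empty)
    then show ?thesis using False weight_nonneg[OF f W(1)] by simp
  next
    case True
    have acyclic: "set q \<notin> minimal_cycles H" if "sublist q W" for q
      using positive_weight_acyclic[OF f zero W(1) True that] .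
    then have "distinct W" using acyclic_distinct(1)[OF W(1)] by (simp add: distinct_map)
    then have len: "length W \<le> card (arcs H)"
      using W(1) by (metis walk_def card_mono distinct_card finite_arcs)
    have arcs: "hd W \<in> arcs H" "last W \<in> arcs H"
      using W by (auto simp: walk_def)
    show ?thesis
    proof (cases "is_sink H (head H (last W))")
      case False
      then have "head H (last W) \<in> internal_verts H" using internal_headI arcs by blast
      then have "out_arcs H (head H (last W)) \<noteq> {}"
        using internal_out_degree by (force simp: out_degree_def)
      then obtain h where "h \<in> arcs H" "tail H h = head H (last W)" by auto
      then have w: "walk (W @ [h])" using W by (auto simp: walk_append walk_Cons)
      have "through_weight ?K a (W @ [h]) = weight f (W @ [h])"
        "through_weight ?K a (W @ [out_twin h]) = weight f (W @ [out_twin h])"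
        using less.hyps[of "W @ [h]"] less.hyps[of "W @ [out_twin h]"] w
          walk_snoc_twin[OF w W(2)] len by auto
      then show ?thesis
        using through_weight_split_out[OF finite_positive_walks positive_walks_Routes w W(2)]
          weight_split_out[OF w W(2)] by metis
    next
      case sink: True
      show ?thesis
      proof (cases "is_source H (tail H (hd W))")
        case False
        then have "tail H (hd W) \<in> internal_verts H" using internal_tailI arcs by blast
        then have "in_arcs H (tail H (hd W)) \<noteq> {}"
          using internal_in_degree by (force simp: in_degree_def)
        then obtain e where "e \<in> arcs H" "head H e = tail H (hd W)" by auto
        then have w: "walk (e # W)" using W by (auto simp: walk_Cons)
        have "through_weight ?K a (e # W) = weight f (e # W)"
          "through_weight ?K a (in_twin e # W) = weight f (in_twin e # W)"
          using less.hyps[of "e # W"] less.hyps[of "in_twin e # W"] w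
            walk_Cons_twin[OF w W(2)] len by auto
        then show ?thesis
          using through_weight_split_in[OF finite_positive_walks positive_walks_Routes w W(2)]
            weight_split_in[OF f w W(2)] by metis
      next
        case source: True
        have good: "good_walk H W"
          using W source sink acyclic by (auto simp: good_walk_def source_sink_walk_iff)
        have "{\<rho> \<in> ?K. route_contains \<rho> W} = {Walk_Route W}"
          using source_sink_maximal[OF good] good_walkD(2) good True
          by (auto simp: positive_walks_def)
        then show ?thesis unfolding through_weight_def using a by simp
      qed
    qed
  qed
qed

section \<open>Removing the cycles and assembling the decomposition\<close>

lemma decomposition_exists:
  assumes f: "f \<in> nonneg_flows H"
  shows "\<exists>K a. route_decomposition H col f K a"
proof -
  \<comment> \<open>\<open>m C\<close> is the largest multiple of the cycle that fits into
    \<open>f\<close>, and \<open>g\<close> is the flow left for the walks.\<close>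
  define m where "m C = Min (f ` C)" for C
  define g where "g e = f e - (\<Sum>C \<in> minimal_cycles H. m C * indicator C e)" for e
  define a where "a \<rho> = (case \<rho> of Walk_Route p \<Rightarrow> weight g p | Cycle_Route C \<Rightarrow> m C)" for \<rho>
  \<comment> \<open>Cycles with minimum 0 are left out because coefficients must be positive; they
    contribute nothing to the sum.\<close>
  define Z where "Z = {C \<in> minimal_cycles H. 0 < m C}"
  define K where "K = positive_walks g \<union> Cycle_Route ` Z"
  have fin: "finite C" "C \<noteq> {}" if "C \<in> minimal_cycles H" for C
    using minimal_cycle_closed_walk[OF that] by (auto simp: closed_walk_def)
  have m_attained: "\<exists>e \<in> C. f e = m C" if "C \<in> minimal_cycles H" for C
    using Min_in[of "f ` C"] fin[OF that] unfolding m_def by fastforce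
  have m_le: "m C \<le> f e" if "C \<in> minimal_cycles H" "e \<in> C" for C e
    using fin that by (simp add: m_def)
  have m_nonneg: "0 \<le> m C" if "C \<in> minimal_cycles H" for C
    using m_attained[OF that] f minimal_cycle_arcs[OF that] by (fastforce simp: nonneg_flows_def)
  have g_on: "g e = f e - m C" if "C \<in> minimal_cycles H" "e \<in> C" for C e
  proof -
    \<comment> \<open>By disjointness \<open>C\<close> is the only minimal cycle through
      \<open>e\<close>.\<close>
    have "(\<Sum>D \<in> minimal_cycles H. m D * indicator D e) = (\<Sum>D \<in> {C}. m D * indicator D e)"
      using finite_minimal_cycles that minimal_cycles_disjoint
      by (intro sum.mono_neutral_right) (auto simp: indicator_def)
    then show ?thesis using that by (simp add: g_def)
  qed
  have g_off: "g e = f e" if "\<And>C. C \<in> minimal_cycles H \<Longrightarrow> e \<notin> C" for e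
    using that by (simp add: g_def)
  have "0 \<le> g e" if "e \<in> arcs H" for e
  proof (cases "\<exists>C \<in> minimal_cycles H. e \<in> C")
    case True
    then show ?thesis using g_on m_le by force
  next
    case False
    then show ?thesis using g_off f that by (auto simp: nonneg_flows_def)
  qed
  moreover have "(\<Sum>e \<in> out_arcs H v. g e) = (\<Sum>e \<in> in_arcs H v. g e)"
    if v: "v \<in> internal_verts H" for v
  proof -
    have *: "(\<Sum>e \<in> A. \<Sum>C \<in> minimal_cycles H. m C * indicator C e) =
      (\<Sum>C \<in> minimal_cycles H. m C * (\<Sum>e \<in> A. indicator C e))" for A
      by (subst sum.swap) (simp add: sum_distrib_left)
    have "(\<Sum>e \<in> out_arcs H v. f e) = (\<Sum>e \<in> in_arcs H v. f e)"
      using f v by (auto simp: nonneg_flows_def)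
    then show ?thesis
      unfolding g_def sum_subtractf * using minimal_cycle_balance[OF _ v] by simp
  qed
  ultimately have g: "g \<in> nonneg_flows H" by (auto simp: nonneg_flows_def)
  \<comment> \<open>The edge attaining the minimum on \<open>C\<close> becomes empty, which is what
    keeps walks of positive weight from containing \<open>C\<close>.\<close>
  have zero: "\<exists>e \<in> C. g e = 0" if "C \<in> minimal_cycles H" for C
    using m_attained[OF that] g_on[OF that] by force
  have finK: "finite K"
    using finite_positive_walks finite_minimal_cycles by (simp add: K_def Z_def)
  have walks_sum: "(\<Sum>\<rho> \<in> positive_walks g. a \<rho> * indicator (route_edges \<rho>) e) = g e"
    if "e \<in> arcs H" for e
    using through_weight_singleton[OF finite_positive_walks, of g a e]
      through_weight_positive_walks[OF g zero, of a "[e]"] that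
    by (simp add: a_def walk_Cons)
  have cycles_sum: "(\<Sum>\<rho> \<in> Cycle_Route ` Z. a \<rho> * indicator (route_edges \<rho>) e) =
    (\<Sum>C \<in> minimal_cycles H. m C * indicator C e)" for e
  proof -
    have "(\<Sum>\<rho> \<in> Cycle_Route ` Z. a \<rho> * indicator (route_edges \<rho>) e) =
      (\<Sum>C \<in> Z. m C * indicator C e)"
      by (subst sum.reindex) (auto simp: inj_on_def a_def)
    also have "\<dots> = (\<Sum>C \<in> minimal_cycles H. m C * indicator C e)"
      using m_nonneg finite_minimal_cycles
      by (intro sum.mono_neutral_left) (force simp: Z_def)+
    finally show ?thesis .
  qed
  have "f e = (\<Sum>\<rho> \<in> K. a \<rho> * indicator (route_edges \<rho>) e)" if "e \<in> arcs H" for e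
  proof -
    have "positive_walks g \<inter> Cycle_Route ` Z = {}" by (auto simp: positive_walks_def)
    then have "(\<Sum>\<rho> \<in> K. a \<rho> * indicator (route_edges \<rho>) e) =
      g e + (\<Sum>C \<in> minimal_cycles H. m C * indicator C e)"
      using finK walks_sum[OF that] cycles_sum by (simp add: K_def sum.union_disjoint)
    then show ?thesis by (simp add: g_def)
  qed
  \<comment> \<open>Only two walk routes can be incompatible, so the cycles need no argument
    here.\<close>
  moreover have "pairwise (compatible H col) K"
    using positive_weight_no_crossing[OF g] good_walkD(2)
    unfolding pairwise_def K_def incompatible_def positive_walks_def by blast
  moreover have "K \<subseteq> Routes H"
    using positive_walks_Routes by (auto simp: K_def Z_def Routes_def)
  moreover have "0 < a \<rho>" if "\<rho> \<in> K" for \<rho>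
    using that by (auto simp: K_def Z_def a_def positive_walks_def)
  ultimately show ?thesis using finK unfolding route_decomposition_def by blast
qed

end

theorem theorem6p21:
  fixes H :: "('v, 'e) pre_digraph" and col :: "'e \<Rightarrow> colour" and f :: "'e \<Rightarrow> real"
  assumes "cyclic_ample_framing H col"
    and "f \<in> nonneg_flows H"
  shows "(\<exists>K a. route_decomposition H col f K a) \<and>
    (\<forall>K a K' a'. route_decomposition H col f K a \<and> route_decomposition H col f K' a' \<longrightarrow>
       K = K' \<and> (\<forall>\<rho> \<in> K. a \<rho> = a' \<rho>)) \<and>
    (integer_flow H f \<longrightarrow>
       (\<forall>K a. route_decomposition H col f K a \<longrightarrow> (\<forall>\<rho> \<in> K. a \<rho> \<in> \<int>)))"
proof -
  interpret cyclic_ample_framing H col by (fact assms(1))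
  show ?thesis
    using decomposition_exists[OF assms(2)] decomposition_unique decomposition_integer by blast
qed

end
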